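(* For $c>0$ define $g_c:\mathbb{R}\times\mathbb{R}\to\mathbb{R}$ by $g_c(x,y)=|x-y|$ if $|x-y|<c$ and $g_c(x,y)=c$ otherwise. Then the robust CRPS (rCRPS), defined as $$S^{\mathrm{ker}}_{1,c}(\mathbb{P},y) := \frac12\mathsf{E}_{\mathbb{P},\mathbb{P}}[g_c(X,Y)] - \mathsf{E}_{\mathbb{P}}[g_c(X,y)],$$ is a proper scoring rule on the class of Borel probability measures on $\mathbb{R}$.
   Context: $\mathsf{E}_{\mathbb{P}}$ is expectation for $X\sim\mathbb{P}$; $\mathsf{E}_{\mathbb{P},\mathbb{P}}$ is expectation for independent $X,Y\sim\mathbb{P}$. For a scoring rule $S(\mathbb{P},y)$, $S(\mathbb{P},\mathbb{Q})$ is the expected value of $S(\mathbb{P},Y)$ when $Y\sim\mathbb{Q}$. $S$ is proper on a class $\mathcal{P}$ of probability measures if $S(\mathbb{Q},\mathbb{Q})\ge S(\mathbb{P},\mathbb{Q})$ for all $\mathbb{P},\mathbb{Q}\in\mathcal{P}$. *)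

theory Defs
  imports "HOL-Probability.Probability"
begin

text \<open>
  Integrability is part of being a scoring rule: the Bochner integral is 0 on non-integrable
  functions, so otherwise the expected scores compared in propriety could be meaningless.
\<close>

definition scoring_rule_on :: "'a measure set \<Rightarrow> ('a measure \<Rightarrow> 'a \<Rightarrow> real) \<Rightarrow> bool" where
  "scoring_rule_on \<P> S \<longleftrightarrow> (\<forall>P\<in>\<P>. \<forall>Q\<in>\<P>. integrable Q (S P))"

definition expected_score :: "('a measure \<Rightarrow> 'a \<Rightarrow> real) \<Rightarrow> 'a measure \<Rightarrow> 'a measure \<Rightarrow> real" where
  "expected_score S P Q = (\<integral>y. S P y \<partial>Q)"

definition proper_scoring_rule_on :: "'a measure set \<Rightarrow> ('a measure \<Rightarrow> 'a \<Rightarrow> real) \<Rightarrow> bool" where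
  "proper_scoring_rule_on \<P> S \<longleftrightarrow>
     scoring_rule_on \<P> S \<and>
     (\<forall>P\<in>\<P>. \<forall>Q\<in>\<P>. expected_score S Q Q \<ge> expected_score S P Q)"

definition g :: "real \<Rightarrow> real \<Rightarrow> real \<Rightarrow> real" where
  "g c x y = (if \<bar>x - y\<bar> < c then \<bar>x - y\<bar> else c)"

text \<open>The joint law of independent \<open>X, Y \<sim> P\<close> is the product measure \<open>P \<Otimes>\<^sub>M P\<close>.\<close>

definition rCRPS :: "real \<Rightarrow> real measure \<Rightarrow> real \<Rightarrow> real" where
  "rCRPS c P y = 1 / 2 * (\<integral>(x, x'). g c x x' \<partial>(P \<Otimes>\<^sub>M P)) - (\<integral>x. g c x y \<partial>P)"

end

theory Submission
  imports Defs
begin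

text \<open>
  Since \<open>g c x y = min \<bar>x - y\<bar> c\<close>, the complement \<open>c - g c x y\<close> is the triangular kernel, that is,
  the length of the overlap of the intervals \<open>[x, x + c]\<close> and \<open>[y, y + c]\<close>
  (\<open>triangular_kernel_eq_overlap\<close>). Writing \<open>F\<^sub>P t = P [t - c, t]\<close> for the mass that \<open>P\<close> puts on a
  sliding window of width \<open>c\<close>, Tonelli's theorem turns this into
  \<open>E g c X Y = c - \<integral> F\<^sub>P t * F\<^sub>Q t dt\<close> for independent \<open>X \<sim> P\<close> and \<open>Y \<sim> Q\<close>
  (\<open>expected_g_eq_window_mass\<close>). In the score difference \<open>S(Q, Q) - S(P, Q)\<close> the constants cancel and
  the three remaining integrals complete a square: it equals \<open>1/2 * \<integral> (F\<^sub>P t - F\<^sub>Q t)\<^sup>2 dt\<close>, half the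
  squared \<open>L\<^sup>2\<close> distance of the two window masses.
\<close>

lemma g_bounds:
  assumes "c > 0"
  shows "0 \<le> g c x y" "g c x y \<le> c"
  using assms by (auto simp: g_def)

lemma borel_measurable_g [measurable]:
  assumes [measurable]: "f \<in> borel_measurable M" "h \<in> borel_measurable M"
  shows "(\<lambda>z. g c (f z) (h z)) \<in> borel_measurable M"
  unfolding g_def by measurable

definition window_mass :: "real \<Rightarrow> real measure \<Rightarrow> real \<Rightarrow> real" where
  "window_mass c P t = measure P {t - c..t}"

text \<open>
  The window \<open>[t - c, t]\<close> contains both \<open>x\<close> and \<open>y\<close> exactly when \<open>t\<close> lies in
  \<open>[x, x + c] \<inter> [y, y + c]\<close>, an interval of length \<open>c - \<bar>x - y\<bar>\<close> or empty. This separates the two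
  variables of the kernel.
\<close>

lemma triangular_kernel_eq_overlap:
  assumes "c > 0"
  shows "ennreal (c - g c x y) =
    (\<integral>\<^sup>+t. indicator {t - c..t} x * indicator {t - c..t} y \<partial>lborel)"
proof -
  have "(\<integral>\<^sup>+t. indicator {t - c..t} x * indicator {t - c..t} y \<partial>lborel)
      = (\<integral>\<^sup>+t. indicator {max x y..min x y + c} t \<partial>lborel)"
    by (intro nn_integral_cong) (auto simp: indicator_def)
  also have "\<dots> = emeasure lborel {max x y..min x y + c}"
    by simp
  also have "\<dots> = ennreal (c - g c x y)"
    using assms by (auto simp: g_def emeasure_lborel_Icc_eq max_def min_def abs_if)
  finally show ?thesis by simp
qed

lemma borel_measurable_indicator_window:
  "(\<lambda>(t, x). indicator {t - c..t} x :: ennreal) \<in> borel_measurable (borel \<Otimes>\<^sub>M borel)"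
  for c :: real
  unfolding indicator_def atLeastAtMost_iff by measurable

lemma nn_integral_indicator_window:
  assumes "prob_space P" "sets P = sets borel"
  shows "(\<integral>\<^sup>+x. indicator {t - c..t} x \<partial>P) = ennreal (window_mass c P t)"
proof -
  interpret prob_space P by fact
  show ?thesis using assms(2) by (simp add: window_mass_def emeasure_eq_measure)
qed

lemma borel_measurable_window_mass [measurable]:
  assumes "prob_space P" "sets P = sets borel"
  shows "window_mass c P \<in> borel_measurable borel"
proof -
  interpret prob_space P by fact
  note assms(2) [measurable_cong] borel_measurable_indicator_window [measurable]
  have "(\<lambda>t. enn2real (\<integral>\<^sup>+x. indicator {t - c..t} x \<partial>P)) \<in> borel_measurable borel"
    by measurable
  then show ?thesis
    by (simp add: nn_integral_indicator_window [OF assms] window_mass_def [abs_def])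
qed

text \<open>Two applications of Tonelli's theorem move the integral over the window position outermost.\<close>

lemma nn_integral_triangular_kernel:
  assumes c: "c > 0"
    and P: "prob_space P" "sets P = sets borel"
    and Q: "prob_space Q" "sets Q = sets borel"
  shows "(\<integral>\<^sup>+y. \<integral>\<^sup>+x. ennreal (c - g c x y) \<partial>P \<partial>Q) =
    (\<integral>\<^sup>+t. ennreal (window_mass c P t * window_mass c Q t) \<partial>lborel)"
proof -
  interpret P: prob_space P by fact
  interpret Q: prob_space Q by fact
  interpret PL: pair_sigma_finite P lborel ..
  interpret QL: pair_sigma_finite Q lborel ..
  note P(2) [measurable_cong] Q(2) [measurable_cong] borel_measurable_indicator_window [measurable]
  note window = nn_integral_indicator_window
  have "(\<integral>\<^sup>+y. \<integral>\<^sup>+x. ennreal (c - g c x y) \<partial>P \<partial>Q) =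
      (\<integral>\<^sup>+y. \<integral>\<^sup>+x. \<integral>\<^sup>+t. indicator {t - c..t} x * indicator {t - c..t} y \<partial>lborel \<partial>P \<partial>Q)"
    by (simp add: triangular_kernel_eq_overlap [OF c])
  also have "\<dots> =
      (\<integral>\<^sup>+y. \<integral>\<^sup>+t. \<integral>\<^sup>+x. indicator {t - c..t} x * indicator {t - c..t} y \<partial>P \<partial>lborel \<partial>Q)"
    by (intro nn_integral_cong PL.Fubini' [symmetric]) measurable
  also have "\<dots> =
      (\<integral>\<^sup>+y. \<integral>\<^sup>+t. ennreal (window_mass c P t) * indicator {t - c..t} y \<partial>lborel \<partial>Q)"
    by (intro nn_integral_cong) (simp add: nn_integral_multc window [OF P])
  also have "\<dots> =
      (\<integral>\<^sup>+t. \<integral>\<^sup>+y. ennreal (window_mass c P t) * indicator {t - c..t} y \<partial>Q \<partial>lborel)"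
    using P by (intro QL.Fubini' [symmetric]) measurable
  also have "\<dots> = (\<integral>\<^sup>+t. ennreal (window_mass c P t) * ennreal (window_mass c Q t) \<partial>lborel)"
    by (intro nn_integral_cong) (simp add: nn_integral_cmult window [OF Q])
  also have "\<dots> = (\<integral>\<^sup>+t. ennreal (window_mass c P t * window_mass c Q t) \<partial>lborel)"
    by (simp add: ennreal_mult window_mass_def)
  finally show ?thesis .
qed

lemma integrable_g:
  assumes c: "c > 0" and P: "prob_space P" "sets P = sets borel"
  shows "integrable P (\<lambda>x. g c x y)"
proof -
  interpret prob_space P by fact
  note P(2) [measurable_cong]
  show ?thesis
    by (rule integrable_const_bound [where B = c]) (use g_bounds [OF c] in auto)
qed

lemma integral_g_bounds:
  assumes c: "c > 0" and P: "prob_space P" "sets P = sets borel"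
  shows "0 \<le> (\<integral>x. g c x y \<partial>P)" "(\<integral>x. g c x y \<partial>P) \<le> c"
proof -
  interpret prob_space P by fact
  show "0 \<le> (\<integral>x. g c x y \<partial>P)"
    using g_bounds [OF c] by (intro integral_nonneg_AE) auto
  show "(\<integral>x. g c x y \<partial>P) \<le> c"
    using integrable_g [OF assms] g_bounds [OF c] by (intro integral_le_const) auto
qed

lemma integrable_integral_g:
  assumes c: "c > 0"
    and P: "prob_space P" "sets P = sets borel"
    and Q: "prob_space Q" "sets Q = sets borel"
  shows "integrable Q (\<lambda>y. \<integral>x. g c x y \<partial>P)"
proof -
  interpret P: prob_space P by fact
  interpret Q: prob_space Q by fact
  note P(2) [measurable_cong] Q(2) [measurable_cong]
  show ?thesis
    by (rule Q.integrable_const_bound [where B = c]) (use integral_g_bounds [OF c P] in auto)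
qed

text \<open>
  The kernel is bounded, so its expectation is finite; this yields the integrability of the product
  of window masses, although the window position ranges over the whole line.
\<close>

lemma
  assumes c: "c > 0"
    and P: "prob_space P" "sets P = sets borel"
    and Q: "prob_space Q" "sets Q = sets borel"
  shows integrable_window_mass_mult:
      "integrable lborel (\<lambda>t. window_mass c P t * window_mass c Q t)"
    and expected_g_eq_window_mass:
      "(\<integral>y. \<integral>x. g c x y \<partial>P \<partial>Q) = c - (\<integral>t. window_mass c P t * window_mass c Q t \<partial>lborel)"
proof -
  interpret P: prob_space P by fact
  interpret Q: prob_space Q by fact
  note P(2) [measurable_cong] Q(2) [measurable_cong]
  note [simp] = integrable_g [OF c P] integrable_integral_g [OF c P Q]
  let ?E = "\<integral>y. \<integral>x. g c x y \<partial>P \<partial>Q"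
  have inner: "(\<integral>\<^sup>+x. ennreal (c - g c x y) \<partial>P) = ennreal (c - (\<integral>x. g c x y \<partial>P))" for y
    using g_bounds [OF c] by (subst nn_integral_eq_integral) (auto simp: P.prob_space)
  have "(\<integral>\<^sup>+y. \<integral>\<^sup>+x. ennreal (c - g c x y) \<partial>P \<partial>Q) = ennreal (c - ?E)"
    unfolding inner using integral_g_bounds [OF c P]
    by (subst nn_integral_eq_integral) (auto simp: Q.prob_space)
  then have nn: "(\<integral>\<^sup>+t. ennreal (window_mass c P t * window_mass c Q t) \<partial>lborel) = ennreal (c - ?E)"
    using nn_integral_triangular_kernel [OF assms] by simp
  have nonneg: "window_mass c P t * window_mass c Q t \<ge> 0" for t
    by (simp add: window_mass_def)
  have meas: "(\<lambda>t. window_mass c P t * window_mass c Q t) \<in> borel_measurable lborel"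
    using P Q by measurable
  show int: "integrable lborel (\<lambda>t. window_mass c P t * window_mass c Q t)"
    using meas nonneg nn by (intro integrableI_nonneg) auto
  have "?E \<le> c"
    using integral_g_bounds [OF c P] by (intro Q.integral_le_const) auto
  then have "(\<integral>t. window_mass c P t * window_mass c Q t \<partial>lborel) = c - ?E"
    using meas nonneg nn by (subst integral_eq_nn_integral) auto
  then show "?E = c - (\<integral>t. window_mass c P t * window_mass c Q t \<partial>lborel)"
    by simp
qed

lemma integral_pair_g:
  assumes c: "c > 0" and P: "prob_space P" "sets P = sets borel"
  shows "(\<integral>(x, x'). g c x x' \<partial>(P \<Otimes>\<^sub>M P)) = (\<integral>y. \<integral>x. g c x y \<partial>P \<partial>P)"
proof -
  interpret P: prob_space P by fact
  interpret PP: pair_prob_space P P ..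
  note P(2) [measurable_cong]
  have "integrable (P \<Otimes>\<^sub>M P) (\<lambda>(x, x'). g c x x')"
    by (rule PP.integrable_const_bound [where B = c]) (use g_bounds [OF c] in auto)
  then show ?thesis by (simp add: PP.integral_snd)
qed

lemma expected_score_rCRPS:
  assumes c: "c > 0"
    and P: "prob_space P" "sets P = sets borel"
    and Q: "prob_space Q" "sets Q = sets borel"
  shows "expected_score (rCRPS c) P Q =
    (\<integral>t. window_mass c P t * window_mass c Q t \<partial>lborel)
      - 1 / 2 * (\<integral>t. window_mass c P t * window_mass c P t \<partial>lborel) - c / 2"
proof -
  interpret Q: prob_space Q by fact
  have "expected_score (rCRPS c) P Q =
      1 / 2 * (\<integral>y. \<integral>x. g c x y \<partial>P \<partial>P) - (\<integral>y. \<integral>x. g c x y \<partial>P \<partial>Q)"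
    unfolding expected_score_def rCRPS_def integral_pair_g [OF c P]
    by (simp add: integrable_integral_g [OF c P Q] Q.prob_space)
  then show ?thesis
    by (simp add: expected_g_eq_window_mass [OF c P P] expected_g_eq_window_mass [OF c P Q]
        algebra_simps)
qed

theorem corollary1:
  fixes c :: real
  assumes "c > 0"
  shows "proper_scoring_rule_on {P :: real measure. prob_space P \<and> sets P = sets borel} (rCRPS c)"
  unfolding proper_scoring_rule_on_def scoring_rule_on_def
proof (intro conjI ballI)
  fix P Q :: "real measure"
  assume "P \<in> {P. prob_space P \<and> sets P = sets borel}" "Q \<in> {P. prob_space P \<and> sets P = sets borel}"
  then have P: "prob_space P" "sets P = sets borel" and Q: "prob_space Q" "sets Q = sets borel"
    by auto
  interpret Q: prob_space Q by fact
  show "integrable Q (rCRPS c P)"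
    unfolding rCRPS_def [abs_def] by (simp add: integrable_integral_g [OF assms P Q])
  let ?F = "window_mass c P" and ?G = "window_mass c Q"
  note [simp] = integrable_window_mass_mult [OF assms P P] integrable_window_mass_mult [OF assms P Q]
    integrable_window_mass_mult [OF assms Q Q]
  have "0 \<le> (\<integral>t. (?F t - ?G t)\<^sup>2 \<partial>lborel)"
    by simp
  also have "\<dots> = (\<integral>t. ?F t * ?F t - 2 * (?F t * ?G t) + ?G t * ?G t \<partial>lborel)"
    by (simp add: power2_eq_square algebra_simps)
  also have "\<dots> = (\<integral>t. ?F t * ?F t \<partial>lborel) - 2 * (\<integral>t. ?F t * ?G t \<partial>lborel)
      + (\<integral>t. ?G t * ?G t \<partial>lborel)"
    by simp
  finally show "expected_score (rCRPS c) Q Q \<ge> expected_score (rCRPS c) P Q"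
    by (simp add: expected_score_rCRPS [OF assms P Q] expected_score_rCRPS [OF assms Q Q])
qed

end
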